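(* Let $k$ be a positive integer and let $W$ be one of the Coxeter groups $A_n$, $B_n$, $D_n$, $I_2(m)$, with degrees $d_1,\dots,d_r$ ($r$ being the rank of $W$) and Coxeter number $h$. Then $$\operatorname{Cat}^{(k)}\{W\}=\prod_{i=1}^{r}\frac{\{kh+d_i\}}{\{d_i\}}$$ is in $\mathbb{N}[s,t]$.
   Context: Let $s,t$ be indeterminates and $\mathbb{N}=\{0,1,2,\dots\}$. The Lucas sequence is $\{0\}=0$, $\{1\}=1$, $\{n\}=s\{n-1\}+t\{n-2\}$ for $n\ge 2$. The degrees and Coxeter numbers $h$ (the largest degree) are: $A_n$ ($n\ge1$): degrees $2,3,4,\dots,n+1$; $h=n+1$. $B_n$ ($n\ge1$): degrees $2,4,6,\dots,2n$; $h=2n$. $D_n$ ($n\ge 3$): degrees $2,4,6,\dots,2(n-1),n$; $h=2(n-1)$. $I_2(m)$ ($m\ge 2$): degrees $2,m$; $h=m$. *)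

theory Defs
  imports
    "HOL-Computational_Algebra.Polynomial"
    "HOL-Computational_Algebra.Fraction_Field"
begin

text \<open>
  The ring \<open>\<int>[s,t]\<close> is the type \<^typ>\<open>int poly poly\<close>: the inner indeterminate is \<open>s\<close>,
  the outer one is \<open>t\<close>, so \<open>coeff (coeff p j) i\<close> is the coefficient of \<open>s\<^sup>i t\<^sup>j\<close> in \<open>p\<close>.
  Quotients are formed in its field of fractions \<open>\<rat>(s,t)\<close>, the type \<^typ>\<open>int poly poly fract\<close>.
\<close>

definition var_s :: "int poly poly" where
  "var_s = [:[:0, 1:]:]"

definition var_t :: "int poly poly" where
  "var_t = [:0, 1:]"

fun lucas :: "nat \<Rightarrow> int poly poly" where
  "lucas 0 = 0"
| "lucas (Suc 0) = 1"
| "lucas (Suc (Suc n)) = var_s * lucas (Suc n) + var_t * lucas n"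

definition embed :: "int poly poly \<Rightarrow> int poly poly fract" where
  "embed p = Fraction_Field.Fract p 1"

text \<open>The semiring \<open>\<nat>[s,t]\<close>, as a subset of \<open>\<rat>(s,t)\<close>.\<close>

definition nat_polys :: "int poly poly fract set" where
  "nat_polys = {embed p | p. \<forall>i j. coeff (coeff p j) i \<ge> 0}"

datatype coxeter = CoxA nat | CoxB nat | CoxD nat | CoxI2 nat

fun admissible :: "coxeter \<Rightarrow> bool" where
  "admissible (CoxA n) \<longleftrightarrow> n \<ge> 1"
| "admissible (CoxB n) \<longleftrightarrow> n \<ge> 1"
| "admissible (CoxD n) \<longleftrightarrow> n \<ge> 3"
| "admissible (CoxI2 m) \<longleftrightarrow> m \<ge> 2"

text \<open>Degrees are kept in a list because they may repeat, e.g. in \<open>D\<^sub>n\<close> for even \<open>n\<close>.\<close>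

fun degrees :: "coxeter \<Rightarrow> nat list" where
  "degrees (CoxA n) = map (\<lambda>i. i + 1) [1..<n + 1]"
| "degrees (CoxB n) = map (\<lambda>i. 2 * i) [1..<n + 1]"
| "degrees (CoxD n) = map (\<lambda>i. 2 * i) [1..<n] @ [n]"
| "degrees (CoxI2 m) = [2, m]"

definition rank :: "coxeter \<Rightarrow> nat" where
  "rank W = length (degrees W)"

fun coxeter_number :: "coxeter \<Rightarrow> nat" where
  "coxeter_number (CoxA n) = n + 1"
| "coxeter_number (CoxB n) = 2 * n"
| "coxeter_number (CoxD n) = 2 * (n - 1)"
| "coxeter_number (CoxI2 m) = m"

definition lucas_cat :: "nat \<Rightarrow> coxeter \<Rightarrow> int poly poly fract" where
  "lucas_cat k W =
    (\<Prod>i<rank W. embed (lucas (k * coxeter_number W + degrees W ! i)) / embed (lucas (degrees W ! i)))"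

lemma coxeter_number_eq_Max:
  assumes "admissible W"
  shows "coxeter_number W = Max (set (degrees W))"
proof (cases W)
  case (CoxA n)
  then show ?thesis using assms by (intro Max_eqI[symmetric]) auto
next
  case (CoxB n)
  then show ?thesis using assms by (intro Max_eqI[symmetric]) auto
next
  case (CoxD n)
  then have "n - 1 \<in> {1..<n}" using assms by auto
  with CoxD show ?thesis using assms by (intro Max_eqI[symmetric]) auto
next
  case (CoxI2 m)
  then show ?thesis using assms by simp
qed

text \<open>The denominators in \<^const>\<open>lucas_cat\<close> do not vanish, so no division by zero occurs there.\<close>

lemma coeff_0_lucas_Suc: "coeff (lucas (Suc n)) 0 = [:0, 1:] ^ n"
  by (induction n rule: lucas.induct) (simp_all add: var_s_def var_t_def)

lemma embed_lucas_degree_nonzero: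
  assumes "admissible W" "i < rank W"
  shows "embed (lucas (degrees W ! i)) \<noteq> 0"
proof -
  have "degrees W ! i \<in> set (degrees W)"
    using assms(2) by (simp add: rank_def)
  moreover have "\<forall>d \<in> set (degrees W). d > 0"
    using assms(1) by (cases W) auto
  ultimately obtain d where d: "degrees W ! i = Suc d"
    using gr0_conv_Suc by blast
  have "coeff (lucas (Suc d)) 0 \<noteq> 0"
    by (simp add: coeff_0_lucas_Suc)
  then have "lucas (Suc d) \<noteq> 0"
    by auto
  then show ?thesis
    unfolding d embed_def by (simp add: Zero_fract_def eq_fract)
qed

end

theory Submission
  imports Defs
begin

text \<open>
  Over \<open>\<real>\<close> the Lucas polynomial \<open>{n}\<close> has an explicit factorization.  Substituting \<open>s = 2 u cos \<theta>\<close>,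
  \<open>t = - u\<^sup>2\<close> turns \<open>{n}\<close> into \<open>u\<^bsup>n-1\<^esup> sin (n \<theta>) / sin \<theta>\<close>, whose zeros in
  \<open>(0, \<pi>)\<close> are the multiples of \<open>\<pi>/n\<close> there.  Pairing the zeros \<open>\<theta>\<close> and \<open>\<pi> - \<theta>\<close> gives
  \<open>{n} = \<Prod> f\<^sub>q\<close> over all \<open>q\<close> in \<open>(0, 1/2]\<close> with \<open>n q\<close> an integer, where
  \<open>f\<^sub>q = s\<^sup>2 + 4 cos\<^sup>2(\<pi> q) t\<close> for \<open>q < 1/2\<close> and \<open>f\<^sub>q = s\<close> for \<open>q = 1/2\<close>
  (lemma \<open>lucas_factorization\<close>).  Every \<open>f\<^sub>q\<close> has nonnegative coefficients.

  If \<open>q\<close> has denominator \<open>d\<close>, the factor \<open>f\<^sub>q\<close> occurs in \<open>{n}\<close> exactly when \<open>d\<close> divides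
  \<open>n\<close>.  So a quotient of products of Lucas polynomials is a polynomial with nonnegative
  real coefficients as soon as, for every \<open>d \<ge> 2\<close>, at least as many indices in the numerator
  as in the denominator are divisible by \<open>d\<close>.  The coefficients are then integers, because the
  denominator is a polynomial in \<open>t\<close> whose constant term is a power of \<open>s\<close>, which makes
  the long division by it integral (lemma \<open>integral_quotient\<close>).

  What is left is arithmetic: for each of the four families, at least as many of the numbers
  \<open>k h + d\<^sub>i\<close> as of the degrees \<open>d\<^sub>i\<close> are multiples of \<open>d\<close>.  This rests on the
  fact that no window of \<open>n\<close> consecutive positive integers contains fewer multiples of \<open>d\<close>
  than \<open>{1..n}\<close>.
\<close>

section \<open>Integer polynomials inside the real ones\<close>

lemma map_poly_hom:
  fixes f :: "'a::comm_semiring_1 \<Rightarrow> 'b::comm_semiring_1"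
  assumes zero: "f 0 = 0" and add: "\<And>x y. f (x + y) = f x + f y"
    and mult: "\<And>x y. f (x * y) = f x * f y"
  shows "map_poly f (p + q) = map_poly f p + map_poly f q"
    and "map_poly f (p * q) = map_poly f p * map_poly f q"
proof -
  have sum: "f (sum g A) = (\<Sum>x\<in>A. f (g x))" for g :: "nat \<Rightarrow> 'a" and A
    by (induction A rule: infinite_finite_induct) (simp_all add: zero add)
  show "map_poly f (p + q) = map_poly f p + map_poly f q"
    by (rule poly_eqI) (simp add: coeff_map_poly zero add)
  show "map_poly f (p * q) = map_poly f p * map_poly f q"
    by (rule poly_eqI) (simp add: coeff_map_poly zero coeff_mult sum mult)
qed

definition realify :: "int poly poly \<Rightarrow> real poly poly" where
  "realify = map_poly (map_poly real_of_int)"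

lemma coeff_realify: "coeff (coeff (realify p) j) i = real_of_int (coeff (coeff p j) i)"
  by (simp add: realify_def coeff_map_poly)

lemma realify_0 [simp]: "realify 0 = 0"
  by (simp add: realify_def)

lemma realify_1 [simp]: "realify 1 = 1"
  by (simp add: realify_def)

lemma realify_add: "realify (p + q) = realify p + realify q"
  by (auto intro!: poly_eqI simp: coeff_realify)

lemma realify_mult: "realify (p * q) = realify p * realify q"
proof -
  have mult: "map_poly real_of_int (a * b) = map_poly real_of_int a * map_poly real_of_int b"
    and add: "map_poly real_of_int (a + b) = map_poly real_of_int a + map_poly real_of_int b"
    for a b
    by (rule map_poly_hom; simp)+
  show ?thesis
    unfolding realify_def by (rule map_poly_hom(2)) (simp_all only: mult add map_poly_0)
qed

lemma realify_prod_list: "realify (prod_list ps) = prod_list (map realify ps)"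
  by (induction ps) (simp_all add: realify_mult)

lemma inj_realify: "realify p = realify q \<Longrightarrow> p = q"
  by (metis coeff_realify of_int_eq_iff poly_eqI)

lemma realify_vars:
  "realify var_s = [:[:0, 1:]:]" "realify var_t = [:0, 1:]"
  by (simp_all add: realify_def var_s_def var_t_def map_poly_pCons)

section \<open>Factorization of the Lucas polynomials over the reals\<close>

text \<open>The factor for \<open>q < 1/2\<close> carries the two zeros \<open>\<theta> = \<pi> q\<close> and \<open>\<theta> = \<pi> - \<pi> q\<close>,
  which share the value of \<open>cos\<^sup>2\<close>.  At \<open>q = 1/2\<close> they coincide in a single simple zero, so the
  factor there is \<open>s\<close> and not \<open>s\<^sup>2\<close>.\<close>

definition lucas_factor :: "real \<Rightarrow> real poly poly" where
  "lucas_factor q = (if q = 1/2 then [:[:0, 1:]:] else [:[:0, 0, 1:], [:4 * (cos (pi * q))\<^sup>2:]:])"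

definition lucas_angles :: "nat \<Rightarrow> real set" where
  "lucas_angles n = {q. 0 < q \<and> q \<le> 1/2 \<and> real n * q \<in> \<int>}"

lemma lucas_angles_conv_image:
  assumes "n > 0"
  shows "lucas_angles n = (\<lambda>j. real j / real n) ` {1..n div 2}"
proof (intro equalityI subsetI)
  fix q assume "q \<in> lucas_angles n"
  then have q: "0 < q" "q \<le> 1/2" "real n * q \<in> \<int>"
    by (auto simp: lucas_angles_def)
  then obtain i where i: "real n * q = of_int i"
    by (auto elim: Ints_cases)
  with q assms have "0 < real_of_int i"
    by (metis mult_pos_pos of_nat_0_less_iff)
  moreover have "2 * real_of_int i \<le> real n"
    using i[symmetric] q(2) mult_left_mono[OF q(2), of "real n"] by simp
  ultimately have "nat i \<in> {1..n div 2}" "real (nat i) = of_int i"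
    by auto
  moreover have "q = real (nat i) / real n"
    using i assms \<open>0 < real_of_int i\<close> by (simp add: field_simps)
  ultimately show "q \<in> (\<lambda>j. real j / real n) ` {1..n div 2}"
    by blast
next
  fix q assume "q \<in> (\<lambda>j. real j / real n) ` {1..n div 2}"
  then obtain j where "j \<in> {1..n div 2}" "q = real j / real n" ..
  then have j: "j \<ge> 1" "2 * j \<le> n" "q = real j / real n"
    by auto
  then have "2 * real j \<le> real n" by linarith
  with j(1) assms show "q \<in> lucas_angles n"
    by (simp add: j(3) lucas_angles_def field_simps)
qed

lemma finite_lucas_angles: "n > 0 \<Longrightarrow> finite (lucas_angles n)"
  by (simp add: lucas_angles_conv_image)

text \<open>This \<open>d\<close> is the denominator of \<open>q\<close> in lowest terms; it is not \<open>1\<close> because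
  \<open>0 < q \<le> 1/2\<close>.\<close>

lemma lucas_angle_denominator:
  assumes "n > 0" "q \<in> lucas_angles n"
  shows "\<exists>d\<ge>2. \<forall>m. real m * q \<in> \<int> \<longleftrightarrow> d dvd m"
proof -
  obtain j where "j \<in> {1..n div 2}" "q = real j / real n"
    using assms by (auto simp: lucas_angles_conv_image)
  then have j: "j \<ge> 1" "2 * j \<le> n" "q = real j / real n"
    by auto
  define g where "g = gcd j n"
  have g: "g > 0" using j g_def by simp
  obtain a d where ad: "j = g * a" "n = g * d"
    unfolding g_def by (meson dvdE gcd_dvd1 gcd_dvd2)
  have cop: "coprime a d"
  proof -
    have "gcd (g * a) (g * d) = g"
      by (metis ad g_def)
    then show ?thesis
      using g by (simp add: gcd_mult_distrib_nat[symmetric] coprime_iff_gcd_eq_1)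
  qed
  have pos: "d > 0" "a > 0" using ad assms(1) j(1) by (auto intro!: Nat.gr0I)
  have q: "q = real a / real d"
    unfolding j(3) ad using g by simp
  have "2 * (g * a) \<le> g * d" using j(2) by (simp only: ad)
  then have "g * (2 * a) \<le> g * d" by (simp add: mult.left_commute)
  then have "d \<ge> 2" using g pos by simp
  moreover have "real m * q \<in> \<int> \<longleftrightarrow> d dvd m" for m
  proof
    assume "real m * q \<in> \<int>"
    then obtain i where "real m * q = of_int i" by (auto elim: Ints_cases)
    then have "real_of_int (int (m * a)) = real_of_int (i * int d)"
      using q pos by (simp add: field_simps)
    then have "int (m * a) = i * int d" by linarith
    then have "int d dvd int (m * a)" by simp
    then have "d dvd m * a" by (simp only: int_dvd_int_iff)
    then show "d dvd m"
      using cop by (metis coprime_commute coprime_dvd_mult_left_iff)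
  next
    assume "d dvd m"
    then obtain c where "m = d * c" ..
    then have "real m * q = real (c * a)" using q pos by simp
    then show "real m * q \<in> \<int>" by simp
  qed
  ultimately show ?thesis by blast
qed

lemma lucas_at_rec:
  "poly (realify (lucas (Suc (Suc n)))) [:t:] =
    [:0, 1:] * poly (realify (lucas (Suc n))) [:t:] + [:t:] * poly (realify (lucas n)) [:t:]"
  by (simp add: realify_add realify_mult realify_vars)

text \<open>With \<open>t\<close> specialized to a real number, \<open>{n}\<close> and its product of factors are monic
  polynomials of equal degree in \<open>s\<close>, so they agree once they agree at as many points as that
  degree.\<close>

lemma lucas_at_monic:
  "degree (poly (realify (lucas (Suc n))) [:t:]) \<le> n \<and>
   coeff (poly (realify (lucas (Suc n))) [:t:]) n = 1"
proof (induction n rule: induct_nat_012)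
  case 0
  then show ?case by simp
next
  case 1
  then show ?case by (simp add: lucas_at_rec del: lucas.simps(3))
next
  case (ge2 n)
  define p where "p = poly (realify (lucas (Suc (Suc n)))) [:t:]"
  define r where "r = poly (realify (lucas (Suc n))) [:t:]"
  have p: "degree p \<le> Suc n" "coeff p (Suc n) = 1" and r: "degree r \<le> n"
    using ge2 by (simp_all add: p_def r_def del: lucas.simps(3))
  have eq: "poly (realify (lucas (Suc (Suc (Suc n))))) [:t:] = pCons 0 p + smult t r"
    by (subst lucas_at_rec) (simp add: p_def r_def del: lucas.simps(3))
  have "degree (pCons 0 p) \<le> Suc (Suc n)"
    using p by (metis degree_pCons_le le_trans not_less_eq_eq)
  moreover have "degree (smult t r) \<le> Suc (Suc n)"
    using r degree_smult_le[of t r] by linarith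
  ultimately have "degree (pCons 0 p + smult t r) \<le> Suc (Suc n)"
    by (rule degree_add_le)
  moreover have "coeff (pCons 0 p + smult t r) (Suc (Suc n)) = 1"
    using p r by (simp add: coeff_eq_0)
  ultimately show ?case by (simp only: eq)
qed

text \<open>Up to the power of \<open>u\<close>, these values are those of the Chebyshev polynomials of the
  second kind; the recursion is the addition theorem for the sine.\<close>

lemma lucas_at_trig:
  "poly (poly (realify (lucas n)) [:-(u\<^sup>2):]) (2 * u * cos \<theta>) * (u * sin \<theta>) =
     u ^ n * sin (real n * \<theta>)"
proof (induction n rule: lucas.induct)
  case (3 n)
  have "sin (real (Suc (Suc n)) * \<theta>) + sin (real n * \<theta>) =
      2 * cos \<theta> * sin (real (Suc n) * \<theta>)"
  proof -
    have "real (Suc (Suc n)) * \<theta> = real (Suc n) * \<theta> + \<theta>"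
      and "real n * \<theta> = real (Suc n) * \<theta> - \<theta>"
      by (simp_all add: algebra_simps)
    then show ?thesis by (simp only: sin_add sin_diff) (simp add: algebra_simps)
  qed
  then have *: "sin (real (Suc (Suc n)) * \<theta>) =
      2 * cos \<theta> * sin (real (Suc n) * \<theta>) - sin (real n * \<theta>)"
    by linarith
  define A where "A = poly (poly (realify (lucas (Suc n))) [:-(u\<^sup>2):]) (2 * u * cos \<theta>)"
  define B where "B = poly (poly (realify (lucas n)) [:-(u\<^sup>2):]) (2 * u * cos \<theta>)"
  have "poly (poly (realify (lucas (Suc (Suc n)))) [:-(u\<^sup>2):]) (2 * u * cos \<theta>) * (u * sin \<theta>)
      = 2 * u * cos \<theta> * (A * (u * sin \<theta>)) - u\<^sup>2 * (B * (u * sin \<theta>))"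
    by (subst lucas_at_rec) (simp add: A_def B_def algebra_simps del: lucas.simps(3))
  also have "\<dots> = 2 * u * cos \<theta> * (u ^ Suc n * sin (real (Suc n) * \<theta>))
      - u\<^sup>2 * (u ^ n * sin (real n * \<theta>))"
    using 3 unfolding A_def B_def by (simp only:)
  also have "\<dots> = u ^ Suc (Suc n) * sin (real (Suc (Suc n)) * \<theta>)"
    unfolding * by (simp add: algebra_simps power2_eq_square)
  finally show ?case .
qed simp_all

lemma lucas_factor_at:
  "poly (lucas_factor q) [:t:] =
    (if q = 1/2 then [:0, 1:] else [:4 * (cos (pi * q))\<^sup>2 * t, 0, 1:])"
  by (simp add: lucas_factor_def)

lemma lucas_factor_product_at_monic:
  fixes t :: real
  assumes "n > 0"
  defines "R \<equiv> poly (\<Prod>q\<in>lucas_angles n. lucas_factor q) [:t:]"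
  shows "degree R = n - 1" "coeff R (n - 1) = 1"
proof -
  have R: "R = (\<Prod>q\<in>lucas_angles n. poly (lucas_factor q) [:t:])"
    by (simp add: R_def poly_prod)
  have inj: "inj_on (\<lambda>j. real j / real n) {1..n div 2}"
    using assms(1) by (auto simp: inj_on_def)
  have "degree R = (\<Sum>q\<in>lucas_angles n. degree (poly (lucas_factor q) [:t:]))"
    unfolding R by (intro degree_prod_sum_eq) (simp add: lucas_factor_at)
  also have "\<dots> = (\<Sum>q\<in>lucas_angles n. if q = 1/2 then 1 else 2)"
    by (intro sum.cong) (auto simp: lucas_factor_at)
  also have "\<dots> = (\<Sum>j\<in>{1..n div 2}. if 2 * j = n then 1 else 2)"
    unfolding lucas_angles_conv_image[OF assms(1)] sum.reindex[OF inj]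
    using assms(1) by (intro sum.cong) (auto simp: field_simps)
  also have "\<dots> = n - 1"
  proof (cases "even n")
    case True
    with assms(1) obtain c where c: "n = 2 * Suc c"
      by (metis dvdE gr0_implies_Suc mult_0_right not_gr_zero)
    have "(\<Sum>j\<in>{1..n div 2}. if 2 * j = n then 1 else 2) =
        (\<Sum>j\<in>{1..c}. if 2 * j = n then 1 else 2) + (1::nat)"
      using c by simp
    also have "(\<Sum>j\<in>{1..c}. if 2 * j = n then 1 else 2) = (\<Sum>j\<in>{1..c}. (2::nat))"
      using c by (intro sum.cong) auto
    finally show ?thesis using c by simp
  next
    case False
    then have "(\<Sum>j\<in>{1..n div 2}. if 2 * j = n then 1 else 2) = (\<Sum>j\<in>{1..n div 2}. (2::nat))"
      by (intro sum.cong) auto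
    with False show ?thesis by simp presburger
  qed
  finally show deg: "degree R = n - 1" .
  have "lead_coeff R = 1"
    unfolding R lead_coeff_prod by (intro prod.neutral) (simp add: lucas_factor_at)
  with deg show "coeff R (n - 1) = 1" by simp
qed

text \<open>For \<open>t = - u\<^sup>2\<close> both sides are monic of degree \<open>n - 1\<close> in \<open>s\<close> and vanish at the
  \<open>n - 1\<close> points \<open>2 u cos (\<pi> j / n)\<close>.  Agreement for infinitely many values of \<open>t\<close> is
  agreement as polynomials.\<close>

theorem lucas_factorization:
  assumes "n > 0"
  shows "realify (lucas n) = (\<Prod>q\<in>lucas_angles n. lucas_factor q)"
proof -
  define L where "L = realify (lucas n)"
  define R where "R = (\<Prod>q\<in>lucas_angles n. lucas_factor q)"
  obtain n' where n': "n = Suc n'" using assms gr0_conv_Suc by blast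
  have at: "poly L [:-(u\<^sup>2):] = poly R [:-(u\<^sup>2):]" if u: "u > 0" for u :: real
  proof (rule poly_eqI_degree_lead_coeff
      [where n = "n - 1" and A = "(\<lambda>j. 2 * u * cos (pi * real j / real n)) ` {1..n-1}"])
    show "coeff (poly L [:-(u\<^sup>2):]) (n - 1) = coeff (poly R [:-(u\<^sup>2):]) (n - 1)"
      using lucas_factor_product_at_monic[OF assms] lucas_at_monic[of n'] n'
      by (simp add: L_def R_def)
    show "degree (poly L [:-(u\<^sup>2):]) \<le> n - 1"
      using lucas_at_monic[of n'] n' by (simp add: L_def)
    show "degree (poly R [:-(u\<^sup>2):]) \<le> n - 1"
      using lucas_factor_product_at_monic[OF assms] by (simp add: R_def)
    have angle: "0 \<le> pi * real j / real n" "pi * real j / real n \<le> pi" if "j \<le> n" for j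
      using that assms by (simp_all add: field_simps)
    have "inj_on (\<lambda>j. 2 * u * cos (pi * real j / real n)) {1..n-1}"
    proof (rule inj_onI)
      fix i j assume ij: "i \<in> {1..n-1}" "j \<in> {1..n-1}"
        and eq: "2 * u * cos (pi * real i / real n) = 2 * u * cos (pi * real j / real n)"
      have "pi * real i / real n = pi * real j / real n"
        by (rule cos_inj_pi) (use eq u ij in \<open>auto intro!: angle simp del: times_divide_eq_right\<close>)
      then show "i = j" using assms by simp
    qed
    then show "n - 1 \<le> card ((\<lambda>j. 2 * u * cos (pi * real j / real n)) ` {1..n-1})"
      by (simp add: card_image)
    fix z assume "z \<in> (\<lambda>j. 2 * u * cos (pi * real j / real n)) ` {1..n-1}"
    then obtain j where j: "1 \<le> j" "j < n" and z: "z = 2 * u * cos (pi * real j / real n)"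
      using assms by auto
    define \<theta> where "\<theta> = pi * real j / real n"
    have "0 < \<theta>" "\<theta> < pi" using j by (simp_all add: \<theta>_def field_simps)
    then have "sin \<theta> > 0" by (rule sin_gt_zero)
    moreover have "sin (real n * \<theta>) = 0"
    proof -
      have "real n * \<theta> = real j * pi" using assms by (simp add: \<theta>_def)
      then show ?thesis by (simp only: sin_npi)
    qed
    ultimately have L0: "poly (poly L [:-(u\<^sup>2):]) z = 0"
      using lucas_at_trig[of n u \<theta>] u by (simp add: L_def z \<theta>_def)
    \<comment> \<open>The factor that vanishes belongs to whichever of \<open>j/n\<close> and \<open>1 - j/n\<close> is at most \<open>1/2\<close>.\<close>
    define i where "i = (if 2 * j \<le> n then j else n - j)"
    define q where "q = real i / real n"
    have "i \<in> {1..n div 2}" using j by (auto simp: i_def)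
    then have q: "q \<in> lucas_angles n"
      unfolding lucas_angles_conv_image[OF assms] q_def by blast
    have cos: "(cos (pi * q))\<^sup>2 = (cos \<theta>)\<^sup>2"
    proof (cases "2 * j \<le> n")
      case True
      then show ?thesis by (simp add: q_def i_def \<theta>_def)
    next
      case False
      then have "pi * q = pi - \<theta>"
        using j by (simp add: q_def i_def \<theta>_def of_nat_diff field_simps)
      then show ?thesis by simp
    qed
    have "poly (poly (lucas_factor q) [:-(u\<^sup>2):]) z = 0"
    proof (cases "q = 1/2")
      case True
      then have "cos \<theta> = 0" using cos unfolding True by simp
      then show ?thesis using True by (simp add: lucas_factor_at z flip: \<theta>_def)
    next
      case False
      then show ?thesis
        using cos by (simp add: lucas_factor_at z power2_eq_square algebra_simps flip: \<theta>_def)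
    qed
    then have "poly (poly R [:-(u\<^sup>2):]) z = 0"
      unfolding R_def poly_prod using q finite_lucas_angles[OF assms]
      by (simp add: prod_zero_iff) blast
    with L0 show "poly (poly L [:-(u\<^sup>2):]) z = poly (poly R [:-(u\<^sup>2):]) z"
      by simp
  qed
  have "L - R = 0"
  proof (rule ccontr)
    assume "L - R \<noteq> 0"
    then have "finite {x. poly (L - R) x = 0}" by (rule poly_roots_finite)
    moreover have "(\<lambda>u. [:-(u\<^sup>2):]) ` {0<..} \<subseteq> {x. poly (L - R) x = 0}"
      using at by auto
    ultimately have "finite ((\<lambda>u::real. [:-(u\<^sup>2):]) ` {0<..})"
      by (rule rev_finite_subset)
    moreover have "inj_on (\<lambda>u::real. [:-(u\<^sup>2):]) {0<..}"
      by (auto simp: inj_on_def power2_eq_iff)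
    ultimately have "finite {0::real<..}" by (rule finite_imageD)
    then show False using infinite_Ioi by blast
  qed
  then show ?thesis by (simp add: L_def R_def)
qed

section \<open>Quotients of products of Lucas polynomials\<close>

definition nonneg_coeffs :: "real poly poly \<Rightarrow> bool" where
  "nonneg_coeffs p \<longleftrightarrow> (\<forall>i j. coeff (coeff p j) i \<ge> 0)"

lemma nonneg_coeffs_1: "nonneg_coeffs 1"
  by (auto simp: nonneg_coeffs_def coeff_1)

lemma nonneg_coeffs_mult: "nonneg_coeffs p \<Longrightarrow> nonneg_coeffs q \<Longrightarrow> nonneg_coeffs (p * q)"
  by (auto simp: nonneg_coeffs_def coeff_mult coeff_sum intro!: sum_nonneg mult_nonneg_nonneg)

lemma nonneg_coeffs_power: "nonneg_coeffs p \<Longrightarrow> nonneg_coeffs (p ^ n)"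
  by (induction n) (simp_all add: nonneg_coeffs_1 nonneg_coeffs_mult)

lemma nonneg_coeffs_prod: "(\<And>x. x \<in> A \<Longrightarrow> nonneg_coeffs (p x)) \<Longrightarrow> nonneg_coeffs (prod p A)"
  by (induction A rule: infinite_finite_induct) (simp_all add: nonneg_coeffs_1 nonneg_coeffs_mult)

lemma nonneg_coeffs_lucas_factor: "nonneg_coeffs (lucas_factor q)"
  by (auto simp: nonneg_coeffs_def lucas_factor_def coeff_pCons split: nat.split)

text \<open>Comparing coefficients of \<open>t\<^sup>j\<close> in \<open>N = D Q\<close> expresses \<open>s\<^sup>m\<close> times the \<open>j\<close>-th coefficient of
  \<open>Q\<close> through integer polynomials and earlier coefficients of \<open>Q\<close>, and multiplication by
  \<open>s\<^sup>m\<close> only shifts coefficients.\<close>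

lemma integral_quotient:
  assumes eq: "realify N = realify D * Q" and D0: "coeff D 0 = [:0, 1:] ^ m"
  shows "\<exists>Z. Q = realify Z \<and> N = D * Z"
proof -
  have int: "\<forall>i. coeff (coeff Q j) i \<in> \<int>" for j
  proof (induction j rule: less_induct)
    case (less j)
    have "coeff (realify D) 0 = map_poly real_of_int (monom 1 m)"
      by (simp add: realify_def coeff_map_poly D0 monom_altdef)
    then have R0: "coeff (realify D) 0 = monom 1 m"
      by (simp add: map_poly_monom)
    have "coeff (realify N) j = (\<Sum>l\<le>j. coeff (realify D) l * coeff Q (j - l))"
      by (simp add: eq coeff_mult)
    also have "\<dots> = monom 1 m * coeff Q j + (\<Sum>l\<in>{1..j}. coeff (realify D) l * coeff Q (j - l))"
      unfolding R0[symmetric] atMost_atLeast0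
      by (subst sum.atLeast_Suc_atMost) simp_all
    finally have shift: "monom 1 m * coeff Q j =
        coeff (realify N) j - (\<Sum>l\<in>{1..j}. coeff (realify D) l * coeff Q (j - l))"
      by simp
    show ?case
    proof
      fix i
      have "coeff (coeff Q j) i = coeff (monom 1 m * coeff Q j) (i + m)"
        by (simp add: coeff_monom_mult)
      also have "\<dots> \<in> \<int>"
        unfolding shift using less
        by (auto simp: coeff_sum coeff_mult coeff_realify intro!: Ints_diff Ints_sum Ints_mult)
      finally show "coeff (coeff Q j) i \<in> \<int>" .
    qed
  qed
  define Z where "Z = map_poly (map_poly floor) Q"
  have "Q = realify Z"
    using int by (intro poly_eqI) (simp add: coeff_realify Z_def coeff_map_poly)
  moreover from this have "N = D * Z"
    using eq by (intro inj_realify) (simp add: realify_mult)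
  ultimately show ?thesis by blast
qed

definition num_multiples :: "nat \<Rightarrow> nat list \<Rightarrow> nat" where
  "num_multiples d xs = (\<Sum>a\<leftarrow>xs. of_bool (d dvd a))"

text \<open>A common index set \<open>T\<close> for several products of Lucas polynomials reduces their quotients to
  differences of exponents.\<close>

lemma lucas_prod_list_factorization:
  assumes "finite T" "\<And>a. a \<in> set xs \<Longrightarrow> a > 0 \<and> lucas_angles a \<subseteq> T" "T \<subseteq> {q. 0 < q \<and> q \<le> 1/2}"
  shows "prod_list (map (\<lambda>a. realify (lucas a)) xs) =
    (\<Prod>q\<in>T. lucas_factor q ^ (\<Sum>a\<leftarrow>xs. of_bool (real a * q \<in> \<int>)))"
  using assms(2)
proof (induction xs)
  case (Cons a xs)
  have a: "a > 0" "lucas_angles a \<subseteq> T" using Cons.prems by auto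
  have "realify (lucas a) = (\<Prod>q\<in>lucas_angles a. lucas_factor q)"
    by (rule lucas_factorization[OF a(1)])
  also have "\<dots> = (\<Prod>q\<in>lucas_angles a. lucas_factor q ^ of_bool (real a * q \<in> \<int>))"
    by (intro prod.cong) (auto simp: lucas_angles_def)
  also have "\<dots> = (\<Prod>q\<in>T. lucas_factor q ^ of_bool (real a * q \<in> \<int>))"
    using assms(1,3) a(2) by (intro prod.mono_neutral_left) (auto simp: lucas_angles_def)
  finally show ?case
    using Cons by (simp add: power_add prod.distrib)
qed simp

text \<open>The exponent of a factor whose angle has denominator \<open>d\<close> is the number of multiples of \<open>d\<close>
  among the indices, so the hypothesis says that no factor has a negative exponent in the
  quotient.\<close>

lemma lucas_prod_list_quotient:
  assumes xs: "\<And>a. a \<in> set xs \<Longrightarrow> a > 0" and ys: "\<And>a. a \<in> set ys \<Longrightarrow> a > 0"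
    and le: "\<And>d. d \<ge> 2 \<Longrightarrow> num_multiples d xs \<le> num_multiples d ys"
  shows "\<exists>Z. prod_list (map lucas ys) = prod_list (map lucas xs) * Z \<and>
    (\<forall>i j. coeff (coeff Z j) i \<ge> 0)"
proof -
  define T where "T = (\<Union>a\<in>set xs \<union> set ys. lucas_angles a)"
  define c where "c zs q = (\<Sum>a\<leftarrow>zs. of_bool (real a * q \<in> \<int>) :: nat)" for zs q
  define Q where "Q = (\<Prod>q\<in>T. lucas_factor q ^ (c ys q - c xs q))"
  have T: "finite T" "T \<subseteq> {q. 0 < q \<and> q \<le> 1/2}"
    using xs ys finite_lucas_angles by (auto simp: T_def lucas_angles_def)
  have c: "c xs q \<le> c ys q" if q: "q \<in> T" for q
  proof -
    obtain a where a: "a \<in> set xs \<union> set ys" "q \<in> lucas_angles a"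
      using q unfolding T_def by blast
    then have "a > 0" using xs ys by auto
    with a(2) obtain d where d: "d \<ge> 2" "\<forall>m. real m * q \<in> \<int> \<longleftrightarrow> d dvd m"
      using lucas_angle_denominator by blast
    then show ?thesis using le[OF d(1)] by (simp add: c_def num_multiples_def)
  qed
  have fact: "realify (prod_list (map lucas zs)) = (\<Prod>q\<in>T. lucas_factor q ^ c zs q)"
    if "set zs \<subseteq> set xs \<union> set ys" for zs
    using that xs ys T unfolding realify_prod_list c_def map_map comp_def
    by (intro lucas_prod_list_factorization) (auto simp: T_def)
  have "realify (prod_list (map lucas ys)) =
      (\<Prod>q\<in>T. lucas_factor q ^ c xs q * lucas_factor q ^ (c ys q - c xs q))"
    using c by (subst fact) (auto simp flip: power_add intro!: prod.cong)
  also have "\<dots> = realify (prod_list (map lucas xs)) * Q"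
    by (subst fact) (auto simp: Q_def prod.distrib)
  finally have eq: "realify (prod_list (map lucas ys)) = realify (prod_list (map lucas xs)) * Q" .
  have "\<exists>m. coeff (prod_list (map lucas xs)) 0 = [:0, 1:] ^ m"
    using xs
  proof (induction xs)
    case Nil
    show ?case by (intro exI[of _ 0]) simp
  next
    case (Cons a xs)
    then obtain m where "coeff (prod_list (map lucas xs)) 0 = [:0, 1:] ^ m" by auto
    moreover obtain b where "a = Suc b" using Cons.prems gr0_conv_Suc by auto
    ultimately show ?case
      by (intro exI[of _ "b + m"]) (simp add: coeff_mult_0 coeff_0_lucas_Suc power_add)
  qed
  then obtain Z where Z: "Q = realify Z" "prod_list (map lucas ys) = prod_list (map lucas xs) * Z"
    using integral_quotient[OF eq] by blast
  have "nonneg_coeffs Q"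
    unfolding Q_def by (intro nonneg_coeffs_prod nonneg_coeffs_power nonneg_coeffs_lucas_factor)
  then show ?thesis
    using Z by (auto simp: nonneg_coeffs_def coeff_realify)
qed

section \<open>Multiples among the degrees\<close>

lemma num_multiples_Nil [simp]: "num_multiples d [] = 0"
  by (simp add: num_multiples_def)

lemma num_multiples_Cons [simp]:
  "num_multiples d (a # xs) = of_bool (d dvd a) + num_multiples d xs"
  by (simp add: num_multiples_def)

lemma num_multiples_append [simp]:
  "num_multiples d (xs @ ys) = num_multiples d xs + num_multiples d ys"
  by (simp add: num_multiples_def)

lemma num_multiples_interval:
  assumes "a \<le> b"
  shows "num_multiples d (map (\<lambda>i. m + i) [Suc a..<Suc b]) = (m + b) div d - (m + a) div d"
    and "(m + a) div d \<le> (m + b) div d"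
proof -
  have *: "num_multiples d (map (\<lambda>i. m + i) [Suc a..<Suc b]) + (m + a) div d = (m + b) div d"
    using assms
  proof (induction b rule: dec_induct)
    case (step b)
    then show ?case by (auto simp: div_Suc dvd_eq_mod_eq_0)
  qed simp
  then show "num_multiples d (map (\<lambda>i. m + i) [Suc a..<Suc b]) = (m + b) div d - (m + a) div d"
    and "(m + a) div d \<le> (m + b) div d"
    by linarith+
qed

lemma num_multiples_window_ge:
  "num_multiples d [1..<Suc n] \<le> num_multiples d (map (\<lambda>i. m + i) [1..<Suc n])"
proof -
  have "m div d + n div d \<le> (m + n) div d"
    using div_add1_eq[of m n d] by simp
  then show ?thesis
    using num_multiples_interval[of 0 n d 0] num_multiples_interval[of 0 n d m] by simp
qed

text \<open>Halving turns the even degrees of types \<open>B\<close> and \<open>D\<close>, and their translates by the even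
  numbers \<open>kh\<close>, into windows of consecutive integers.\<close>

lemma num_multiples_double:
  "num_multiples d (map (\<lambda>i. 2 * f i) xs) = num_multiples (d div gcd d 2) (map f xs)"
proof -
  have "d dvd 2 * a \<longleftrightarrow> d div gcd d 2 dvd a" for a
  proof (cases "even d")
    case True
    then obtain e where "d = 2 * e" ..
    then show ?thesis by simp
  next
    case False
    then have "coprime d 2" by simp
    then show ?thesis by (simp add: coprime_dvd_mult_right_iff)
  qed
  then show ?thesis by (induction xs) simp_all
qed

definition shifted_degrees :: "nat \<Rightarrow> coxeter \<Rightarrow> nat list" where
  "shifted_degrees k W = map (\<lambda>d. k * coxeter_number W + d) (degrees W)"

text \<open>The window \<open>kh + 2, \<dots>, kh + h\<close> misses the first of \<open>h\<close> consecutive numbers.  This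
  could only hurt if \<open>d\<close> divides \<open>kh + 1\<close>; then \<open>d\<close> does not divide \<open>h\<close>, and the
  \<open>h\<close> numbers beginning with a multiple of \<open>d\<close> contain one more multiple than \<open>{1..h}\<close>.\<close>

lemma num_multiples_A:
  assumes "d \<ge> 2"
  shows "num_multiples d (degrees (CoxA n)) \<le> num_multiples d (shifted_degrees k (CoxA n))"
proof -
  define M where "M = k * Suc n"
  have deg: "degrees (CoxA n) = map (\<lambda>i. 0 + i) [Suc 1..<Suc (Suc n)]"
    by (rule nth_equalityI) (auto simp del: upt_Suc)
  have sh: "shifted_degrees k (CoxA n) = map (\<lambda>i. M + i) [Suc 1..<Suc (Suc n)]"
    unfolding shifted_degrees_def deg by (simp add: M_def comp_def del: upt_Suc)
  have div1: "(0 + 1) div d = 0" using assms by simp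
  have "(M + 1) div d + Suc n div d \<le> (M + Suc n) div d"
  proof (cases "d dvd M + 1")
    case False
    then have "(M + 1) div d = M div d"
      by (simp add: div_Suc dvd_eq_mod_eq_0)
    then show ?thesis using div_add1_eq[of M "Suc n" d] by simp
  next
    case True
    have "\<not> d dvd Suc n"
    proof
      assume "d dvd Suc n"
      then have "d dvd M" unfolding M_def by (rule dvd_mult)
      with True have "d dvd 1" using dvd_add_right_iff by blast
      with assms show False by simp
    qed
    then have "Suc n div d = n div d"
      by (simp add: div_Suc dvd_eq_mod_eq_0)
    moreover have "(M + Suc n) div d \<ge> (M + 1) div d + n div d"
      using div_add1_eq[of "M + 1" n d] by simp
    ultimately show ?thesis by simp
  qed
  moreover have "num_multiples d (map (\<lambda>i. N + i) [Suc 1..<Suc (Suc n)]) =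
      (N + Suc n) div d - (N + 1) div d" for N
    by (rule num_multiples_interval) simp
  ultimately show ?thesis
    unfolding deg sh using div1 by (simp only:) simp
qed

lemma num_multiples_B:
  "num_multiples d (degrees (CoxB n)) \<le> num_multiples d (shifted_degrees k (CoxB n))"
proof -
  have "shifted_degrees k (CoxB n) = map (\<lambda>i. 2 * (k * n + i)) [1..<Suc n]"
    by (simp add: shifted_degrees_def comp_def algebra_simps del: upt_Suc)
  then show ?thesis
    using num_multiples_window_ge[of "d div gcd d 2" n "k * n"]
      num_multiples_double[of d "\<lambda>i. i"] num_multiples_double[of d "\<lambda>i. k * n + i"]
    by (simp del: upt_Suc)
qed

text \<open>The even degrees alone behave as in type \<open>B\<close>, so the problem is the degree \<open>n\<close>, when
  \<open>d\<close> divides \<open>n\<close> but not \<open>kh\<close>.  Then \<open>e\<close>, the modulus after halving the even numbers,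
  divides \<open>n\<close> but not \<open>m + n\<close> with \<open>m = k (n - 1)\<close>, so the \<open>n - 1\<close> numbers
  \<open>m + 1, \<dots>, m + n - 1\<close> still contain \<open>n / e\<close> multiples of \<open>e\<close>, one more than
  \<open>{1..n-1}\<close>.\<close>

lemma num_multiples_D:
  assumes "d \<ge> 2" "n \<ge> 1"
  shows "num_multiples d (degrees (CoxD n)) \<le> num_multiples d (shifted_degrees k (CoxD n))"
proof -
  define e where "e = d div gcd d 2"
  define m where "m = k * (n - 1)"
  obtain p where p: "n = Suc p" using assms(2) by (cases n) auto
  have de: "d dvd 2 * e"
    unfolding e_def by (metis dvd_div_mult_self dvd_refl gcd_dvd1 gcd_dvd2 mult.commute mult_dvd_mono)
  have ed: "e dvd d" unfolding e_def by (metis dvd_div_mult_self dvd_triv_left gcd_dvd1)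
  have deg: "num_multiples d (degrees (CoxD n)) = num_multiples e [1..<Suc p] + of_bool (d dvd n)"
    using num_multiples_double[of d "\<lambda>i. i"] by (simp add: p e_def del: upt_Suc)
  have "shifted_degrees k (CoxD n) = map (\<lambda>i. 2 * (m + i)) [1..<Suc p] @ [2 * m + n]"
    by (simp add: shifted_degrees_def comp_def algebra_simps p m_def del: upt_Suc)
  then have sh: "num_multiples d (shifted_degrees k (CoxD n)) =
      num_multiples e (map (\<lambda>i. m + i) [1..<Suc p]) + of_bool (d dvd 2 * m + n)"
    using num_multiples_double[of d "\<lambda>i. m + i"] by (simp add: e_def del: upt_Suc)
  show ?thesis
  proof (cases "d dvd n \<and> \<not> d dvd 2 * m + n")
    case False
    then show ?thesis
      using num_multiples_window_ge[of e p m] unfolding deg sh by auto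
  next
    case True
    then have "\<not> d dvd 2 * m" by auto
    then have "\<not> e dvd m" using de by (meson dvd_refl dvd_trans mult_dvd_mono)
    moreover have en: "e dvd n" using ed True dvd_trans by blast
    ultimately have emn: "\<not> e dvd m + n" using dvd_add_left_iff by blast
    have "e > 0" using ed assms(1) by (auto intro!: Nat.gr0I)
    have "(m + n) div e = (m + p) div e"
      using emn p by (simp add: div_Suc dvd_eq_mod_eq_0)
    moreover have "n div e = Suc (p div e)"
      using en p by (simp add: div_Suc dvd_eq_mod_eq_0)
    moreover have "(m + n) div e = m div e + n div e"
      using en \<open>e > 0\<close> by (simp add: div_plus_div_distrib_dvd_right)
    ultimately have "(m + p) div e = m div e + p div e + 1" by simp
    then show ?thesis
      using num_multiples_interval(1)[of 0 p e 0] num_multiples_interval(1)[of 0 p e m] True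
      unfolding deg sh by simp
  qed
qed

lemma num_multiples_I2:
  assumes "d \<ge> 2"
  shows "num_multiples d (degrees (CoxI2 m)) \<le> num_multiples d (shifted_degrees k (CoxI2 m))"
proof (cases "d = 2")
  case True
  then show ?thesis by (auto simp: shifted_degrees_def)
next
  case False
  with assms have "\<not> d dvd 2" by (auto dest: dvd_imp_le)
  then show ?thesis by (auto simp: shifted_degrees_def)
qed

lemma num_multiples_degrees_le:
  assumes "admissible W" "d \<ge> 2"
  shows "num_multiples d (degrees W) \<le> num_multiples d (shifted_degrees k W)"
  using assms num_multiples_A num_multiples_B num_multiples_D num_multiples_I2
  by (cases W) (simp_all del: degrees.simps)

section \<open>Positivity of the Fuss-Catalan polynomials\<close>

lemma embed_1: "embed 1 = 1"
  by (simp add: embed_def One_fract_def)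

lemma embed_mult: "embed (p * q) = embed p * embed q"
  by (simp add: embed_def)

lemma embed_prod_list: "embed (prod_list ps) = prod_list (map embed ps)"
  by (induction ps) (simp_all add: embed_1 embed_mult)

lemma prod_list_map_divide:
  fixes f g :: "'a \<Rightarrow> 'b::field"
  shows "(\<Prod>x\<leftarrow>xs. f x / g x) = prod_list (map f xs) / prod_list (map g xs)"
  by (induction xs) simp_all

theorem theorem5p7:
  fixes k :: nat and W :: coxeter
  assumes "k \<ge> 1" and "admissible W"
  shows "lucas_cat k W \<in> nat_polys"
proof -
  have pos: "\<forall>d \<in> set (degrees W). d > 0"
    using assms(2) by (cases W) auto
  then obtain Z where Z: "\<forall>i j. coeff (coeff Z j) i \<ge> 0"
    "prod_list (map lucas (shifted_degrees k W)) = prod_list (map lucas (degrees W)) * Z"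
    using lucas_prod_list_quotient[of "degrees W" "shifted_degrees k W"]
      num_multiples_degrees_le[OF assms(2)]
    by (auto simp: shifted_degrees_def)
  have "lucas_cat k W =
      (\<Prod>d\<leftarrow>degrees W. embed (lucas (k * coxeter_number W + d)) / embed (lucas d))"
    by (simp add: lucas_cat_def rank_def prod.list_conv_set_nth lessThan_atLeast0)
  also have "\<dots> = embed (prod_list (map lucas (shifted_degrees k W))) /
      embed (prod_list (map lucas (degrees W)))"
    by (simp add: prod_list_map_divide embed_prod_list shifted_degrees_def comp_def)
  also have "\<dots> = embed Z"
  proof -
    have "embed (lucas d) \<noteq> 0" if "d \<in> set (degrees W)" for d
      using that embed_lucas_degree_nonzero[OF assms(2)] by (auto simp: in_set_conv_nth rank_def)
    then have "embed (prod_list (map lucas (degrees W))) \<noteq> 0"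
      by (auto simp: embed_prod_list prod_list_zero_iff)
    then show ?thesis by (simp add: Z(2) embed_mult)
  qed
  finally show ?thesis using Z(1) by (auto simp: nat_polys_def)
qed

end
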